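(* Let $y>x>x'\ge 0$ be real numbers and let $0\le\gamma<1$. Then there exists a value $\lambda>0$ such that the escrow contract with parameters $(x,x',y,\gamma,\lambda)$ is complete (that is, the honest strategy profile $s^*$ is the unique subgame perfect equilibrium of the contract game) if and only if the arbiter is biased in favor of honest parties, i.e. $\gamma<\frac12$.
   Context: The escrow contract: a seller $S$ sells an item to a buyer $B$ for price $x$; the item is worth $y$ to $B$ and $x'$ to $S$, with $y>x>x'$. The arbiter errs (rules against the honest party) with probability $\gamma$; it is called biased in favor of honest parties if $\gamma<\frac12$. The wager size is $\lambda>0$. The contract is the following two-player extensive-form game of perfect information. 1. $S$ chooses send or not send. 2. $B$ observes this and chooses accept or dispute. If $B$ accepts, the game ends. 3. If $B$ disputes, $S$ chooses forfeit or counter, and the game ends. Payoffs (buyer, seller): (send, accept): $(y-x,\ x-x')$; (send, dispute, forfeit): $(y,\ -x')$; (send, dispute, counter): $(y\gamma-(x+\lambda)(1-\gamma),\ x(1-\gamma)-\lambda\gamma-x')$; (not send, accept): $(-x,\ x)$; (not send, dispute, forfeit): $(0,\ 0)$; (not send, dispute, counter): $(-(x+\lambda)\gamma,\ x\gamma-\lambda(1-\gamma))$. A (pure) strategy of a player prescribes an action at each of that player's decision nodes. The honest strategy profile $s^*$ is: $S$ plays send, counters a dispute after send, and forfeits a dispute after not send; $B$ accepts after send and disputes after not send. The contract is complete if $s^*$ is the unique subgame perfect equilibrium. *)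

theory Defs
  imports Complex_Main "HOL-Library.FuncSet"
begin

section \<open>Extensive-form games of perfect information\<close>

text \<open>
  In \<open>Decision i A G\<close> player \<open>i\<close> moves, \<open>A\<close> is the set of available actions, and \<open>G a\<close> is the
  continuation after \<open>a\<close>. Values of \<open>G\<close> outside \<open>A\<close> are not part of the game: no history
  and no strategy defined below involves them.
\<close>

datatype ('i, 'a) game =
    Terminal "'i \<Rightarrow> real"
  | Decision 'i "'a set" "'a \<Rightarrow> ('i, 'a) game"

primrec histories :: "('i, 'a) game \<Rightarrow> 'a list set" where
  "histories (Terminal u) = {[]}"
| "histories (Decision i A G) = insert [] (\<Union>a\<in>A. (#) a ` histories (G a))"

fun subgame :: "('i, 'a) game \<Rightarrow> 'a list \<Rightarrow> ('i, 'a) game" where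
  "subgame (Decision i A G) (a # h) = subgame (G a) h"
| "subgame G h = G"

fun actions :: "('i, 'a) game \<Rightarrow> 'a set" where
  "actions (Decision i A G) = A"
| "actions (Terminal u) = {}"

definition decision_nodes :: "('i, 'a) game \<Rightarrow> 'i \<Rightarrow> 'a list set" where
  "decision_nodes G i = {h \<in> histories G. \<exists>A G'. subgame G h = Decision i A G'}"

text \<open>
  A pure strategy prescribes an available action at each decision node of its player. It is
  extensional (\<open>undefined\<close> at every other list of actions), so that two strategies are equal
  iff they prescribe the same actions.
\<close>

definition strategies :: "('i, 'a) game \<Rightarrow> 'i \<Rightarrow> ('a list \<Rightarrow> 'a) set" where
  "strategies G i = (\<Pi>\<^sub>E h\<in>decision_nodes G i. actions (subgame G h))"

type_synonym ('i, 'a) profile = "'i \<Rightarrow> 'a list \<Rightarrow> 'a"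

definition profiles :: "('i, 'a) game \<Rightarrow> ('i, 'a) profile set" where
  "profiles G = {s. \<forall>i. s i \<in> strategies G i}"

text \<open>The strategy profile that \<open>s\<close> induces in the subgame rooted at \<open>h\<close>.\<close>

definition continuation :: "'a list \<Rightarrow> ('i, 'a) profile \<Rightarrow> ('i, 'a) profile" where
  "continuation h s = (\<lambda>i h'. s i (h @ h'))"

primrec payoff :: "('i, 'a) game \<Rightarrow> ('i, 'a) profile \<Rightarrow> 'i \<Rightarrow> real" where
  "payoff (Terminal u) = (\<lambda>s. u)"
| "payoff (Decision i A G) = (\<lambda>s. payoff (G (s i [])) (continuation [s i []] s))"

definition nash_equilibrium :: "('i, 'a) game \<Rightarrow> ('i, 'a) profile \<Rightarrow> bool" where
  "nash_equilibrium G s \<longleftrightarrow>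
     s \<in> profiles G \<and>
     (\<forall>i. \<forall>t\<in>strategies G i. payoff G (s(i := t)) i \<le> payoff G s i)"

definition subgame_perfect_equilibrium :: "('i, 'a) game \<Rightarrow> ('i, 'a) profile \<Rightarrow> bool" where
  "subgame_perfect_equilibrium G s \<longleftrightarrow>
     s \<in> profiles G \<and>
     (\<forall>i. \<forall>h\<in>decision_nodes G i. nash_equilibrium (subgame G h) (continuation h s))"



section \<open>The escrow contract\<close>

datatype player = Buyer | Seller

datatype action = Send | NotSend | Accept | Dispute | Forfeit | Counter

definition outcome :: "real \<Rightarrow> real \<Rightarrow> (player, action) game" where
  "outcome b s = Terminal (\<lambda>p. case p of Buyer \<Rightarrow> b | Seller \<Rightarrow> s)"

definition escrow :: "real \<Rightarrow> real \<Rightarrow> real \<Rightarrow> real \<Rightarrow> real \<Rightarrow> (player, action) game" where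
  "escrow x x' y \<gamma> lam =
     Decision Seller {Send, NotSend} (\<lambda>a1.
       if a1 = Send then
         Decision Buyer {Accept, Dispute} (\<lambda>a2.
           if a2 = Accept then outcome (y - x) (x - x')
           else Decision Seller {Forfeit, Counter} (\<lambda>a3.
             if a3 = Forfeit then outcome y (- x')
             else outcome (y * \<gamma> - (x + lam) * (1 - \<gamma>)) (x * (1 - \<gamma>) - lam * \<gamma> - x')))
       else
         Decision Buyer {Accept, Dispute} (\<lambda>a2.
           if a2 = Accept then outcome (- x) x
           else Decision Seller {Forfeit, Counter} (\<lambda>a3.
             if a3 = Forfeit then outcome 0 0
             else outcome (- (x + lam) * \<gamma>) (x * \<gamma> - lam * (1 - \<gamma>)))))"

definition honest :: "(player, action) profile" where
  "honest p = (case p of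
     Seller \<Rightarrow> (\<lambda>h. undefined)
       ([] := Send, [Send, Dispute] := Counter, [NotSend, Dispute] := Forfeit)
   | Buyer \<Rightarrow> (\<lambda>h. undefined)
       ([Send] := Accept, [NotSend] := Dispute))"

definition complete_contract :: "real \<Rightarrow> real \<Rightarrow> real \<Rightarrow> real \<Rightarrow> real \<Rightarrow> bool" where
  "complete_contract x x' y \<gamma> lam \<longleftrightarrow>
     (\<forall>s. subgame_perfect_equilibrium (escrow x x' y \<gamma> lam) s \<longleftrightarrow> s = honest)"

text \<open>\<open>\<gamma>\<close> is the probability that the arbiter rules against the honest party.\<close>

definition biased_for_honest :: "real \<Rightarrow> bool" where
  "biased_for_honest \<gamma> \<longleftrightarrow> \<gamma> < 1 / 2"

end

theory Submission
  imports Defs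
begin

text \<open>
  By the one-shot deviation principle, a profile is a subgame perfect equilibrium iff no single
  action is improvable. For the honest profile the binding conditions are that countering is
  optimal after (send, dispute), \<open>\<lambda>\<gamma> \<le> x(1 - \<gamma>)\<close>, and forfeiting is optimal after
  (not send, dispute), \<open>x\<gamma> \<le> \<lambda>(1 - \<gamma>)\<close>. Together they force \<open>\<gamma> \<le> 1/2\<close>, and for
  \<open>\<gamma> = 1/2\<close> they force \<open>\<lambda> = x\<close>; then both are ties, and countering after (not send, dispute)
  gives a second equilibrium. For \<open>\<gamma> < 1/2\<close> the wager \<open>\<lambda> = x\<close> makes every comparison strict.
\<close>

section \<open>The one-shot deviation principle\<close>

lemma continuation_Nil [simp]: "continuation [] s = s"
  by (simp add: continuation_def)

lemma continuation_apply [simp]: "continuation h s i h' = s i (h @ h')"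
  by (simp add: continuation_def)

lemma continuation_continuation [simp]:
  "continuation h' (continuation h s) = continuation (h @ h') s"
  by (simp add: continuation_def)

lemma continuation_fun_upd:
  "continuation h (s(i := t)) = (continuation h s)(i := \<lambda>h'. t (h @ h'))"
  by (auto simp: continuation_def)

lemma decision_nodes_Terminal [simp]: "decision_nodes (Terminal u) i = {}"
  by (auto simp: decision_nodes_def)

lemma decision_nodes_Decision [simp]:
  "decision_nodes (Decision i A G) j =
     (if j = i then {[]} else {}) \<union> (\<Union>a\<in>A. (#) a ` decision_nodes (G a) j)"
  by (auto simp: decision_nodes_def)

lemma strategies_tail:
  assumes "t \<in> strategies (Decision i A G) j" and "a \<in> A"
  shows "(\<lambda>h. t (a # h)) \<in> strategies (G a) j"
proof -
  have node: "h \<in> decision_nodes (G a) j \<longleftrightarrow> a # h \<in> decision_nodes (Decision i A G) j" for h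
    using assms(2) by auto
  show ?thesis
    unfolding strategies_def
  proof (rule PiE_I)
    fix h
    assume "h \<in> decision_nodes (G a) j"
    then have "t (a # h) \<in> actions (subgame (Decision i A G) (a # h))"
      using assms(1) unfolding node strategies_def by (rule PiE_mem[rotated])
    then show "t (a # h) \<in> actions (subgame (G a) h)"
      by simp
  next
    fix h
    assume "h \<notin> decision_nodes (G a) j"
    then show "t (a # h) = undefined"
      using assms(1) unfolding node strategies_def by (rule PiE_arb[rotated])
  qed
qed

lemma strategies_head:
  assumes "t \<in> strategies (Decision i A G) i"
  shows "t [] \<in> A"
  using PiE_mem[OF assms[unfolded strategies_def], of "[]"] by simp

lemma strategies_upd_head:
  assumes "t \<in> strategies (Decision i A G) i" and "a \<in> A"
  shows "t([] := a) \<in> strategies (Decision i A G) i"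
proof -
  \<comment> \<open>\<open>PiE_fun_upd\<close> adds the updated point to the index set; here the
    root is already in it.\<close>
  have root: "insert [] (decision_nodes (Decision i A G) i) = decision_nodes (Decision i A G) i"
    by (rule insert_absorb) simp
  have "t([] := a) \<in> (\<Pi>\<^sub>E h\<in>insert [] (decision_nodes (Decision i A G) i).
      actions (subgame (Decision i A G) h))"
    using assms by (intro PiE_fun_upd) (simp_all add: strategies_def del: decision_nodes_Decision)
  then show ?thesis
    unfolding root strategies_def .
qed

lemma continuation_in_profiles:
  assumes "s \<in> profiles (Decision i A G)" and "a \<in> A"
  shows "continuation [a] s \<in> profiles (G a)"
  unfolding profiles_def
proof (intro CollectI allI)
  fix j
  have "s j \<in> strategies (Decision i A G) j"
    using assms(1) by (simp add: profiles_def)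
  from strategies_tail[OF this assms(2)] show "continuation [a] s j \<in> strategies (G a) j"
    by (simp add: continuation_def)
qed

text \<open>Strategies are extensional, so only values at decision nodes matter; this turns
  uniqueness of the equilibrium into finitely many comparisons.\<close>

lemma profiles_eqI:
  assumes "s \<in> profiles G" and "t \<in> profiles G"
    and "\<And>i h. h \<in> decision_nodes G i \<Longrightarrow> s i h = t i h"
  shows "s = t"
proof
  fix i
  have "s i \<in> strategies G i" "t i \<in> strategies G i"
    using assms by (auto simp: profiles_def)
  then show "s i = t i"
    unfolding strategies_def by (rule PiE_ext) (fact assms(3))
qed

text \<open>Only the action at the current node varies, with later play kept as in \<open>s\<close>.
  On a concrete game this unfolds to payoff inequalities, with no quantifier over strategies. All
  continuations are checked, including those that \<open>s\<close> does not reach.\<close>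

primrec locally_optimal :: "('i, 'a) game \<Rightarrow> ('i, 'a) profile \<Rightarrow> bool" where
  "locally_optimal (Terminal u) = (\<lambda>s. True)"
| "locally_optimal (Decision i A G) = (\<lambda>s.
     (\<forall>a\<in>A. locally_optimal (G a) (continuation [a] s)) \<and>
     (\<forall>a\<in>A. payoff (G a) (continuation [a] s) i
              \<le> payoff (G (s i [])) (continuation [s i []] s) i))"

text \<open>The root is a decision node unless the game is terminal, and then payoffs do not depend
  on the profile.\<close>

lemma subgame_perfect_equilibrium_imp_nash:
  assumes "subgame_perfect_equilibrium G s"
  shows "nash_equilibrium G s"
proof (cases G)
  case (Terminal u)
  then show ?thesis
    using assms by (simp add: subgame_perfect_equilibrium_def nash_equilibrium_def)
next
  case (Decision i A G')
  then have "[] \<in> decision_nodes G i"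
    by simp
  then have "nash_equilibrium (subgame G []) (continuation [] s)"
    using assms unfolding subgame_perfect_equilibrium_def by blast
  then show ?thesis
    using Decision by simp
qed

text \<open>A deviation splits into its root action and a deviation in the subgame reached:
  \<open>nash\<close> bounds the gain from the latter, \<open>best\<close> that from the former. If
  another player deviates, the root action stays fixed and \<open>nash\<close> suffices.\<close>

lemma nash_equilibrium_Decision:
  assumes s: "s \<in> profiles (Decision i A G)"
    and nash: "\<And>a. a \<in> A \<Longrightarrow> nash_equilibrium (G a) (continuation [a] s)"
    and best: "\<And>a. a \<in> A \<Longrightarrow> payoff (G a) (continuation [a] s) i
                 \<le> payoff (G (s i [])) (continuation [s i []] s) i"
  shows "nash_equilibrium (Decision i A G) s"
  unfolding nash_equilibrium_def
proof (intro conjI allI ballI)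
  fix j t
  assume t: "t \<in> strategies (Decision i A G) j"
  have upd: "payoff (G a) (continuation [a] (s(j := t))) j \<le> payoff (G a) (continuation [a] s) j"
    if "a \<in> A" for a
    using nash[OF that] strategies_tail[OF t that]
    by (simp add: nash_equilibrium_def continuation_fun_upd)
  show "payoff (Decision i A G) (s(j := t)) j \<le> payoff (Decision i A G) s j"
  proof (cases "j = i")
    case True
    have "t [] \<in> A"
      using t unfolding True by (rule strategies_head)
    from order_trans[OF upd[OF this] best[OF this, folded True]] show ?thesis
      unfolding True by simp
  next
    case False
    have "s i \<in> strategies (Decision i A G) i"
      using s by (simp add: profiles_def)
    then have "s i [] \<in> A"
      by (rule strategies_head)
    from upd[OF this] show ?thesis
      using False by simp
  qed
qed (fact s)

text \<open>Backward induction as structural induction on the game, which is well-founded because it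
  is a datatype value.\<close>

theorem subgame_perfect_equilibrium_iff_locally_optimal:
  assumes "s \<in> profiles G"
  shows "subgame_perfect_equilibrium G s \<longleftrightarrow> locally_optimal G s"
  using assms
proof (induction G arbitrary: s)
  case (Terminal u)
  then show ?case
    by (simp add: subgame_perfect_equilibrium_def)
next
  case (Decision i A G)
  note s = Decision.prems
  have IH: "subgame_perfect_equilibrium (G a) (continuation [a] s)
      \<longleftrightarrow> locally_optimal (G a) (continuation [a] s)" if "a \<in> A" for a
    using Decision.IH continuation_in_profiles[OF s that] by blast
  show ?case
  proof
    assume spe: "subgame_perfect_equilibrium (Decision i A G) s"
    have "subgame_perfect_equilibrium (G a) (continuation [a] s)" if "a \<in> A" for a
      unfolding subgame_perfect_equilibrium_def
    proof (intro conjI allI ballI)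
      fix j h
      assume "h \<in> decision_nodes (G a) j"
      then have "a # h \<in> decision_nodes (Decision i A G) j"
        using that by auto
      then have "nash_equilibrium (subgame (Decision i A G) (a # h)) (continuation (a # h) s)"
        using spe unfolding subgame_perfect_equilibrium_def by blast
      then show "nash_equilibrium (subgame (G a) h) (continuation h (continuation [a] s))"
        by simp
    qed (fact continuation_in_profiles[OF s that])
    moreover have "payoff (G a) (continuation [a] s) i
        \<le> payoff (G (s i [])) (continuation [s i []] s) i" if "a \<in> A" for a
    proof -
      have "(s i)([] := a) \<in> strategies (Decision i A G) i"
        using s that by (intro strategies_upd_head) (auto simp: profiles_def)
      then have "payoff (Decision i A G) (s(i := (s i)([] := a))) i \<le> payoff (Decision i A G) s i"
        using subgame_perfect_equilibrium_imp_nash[OF spe] unfolding nash_equilibrium_def by blast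
      \<comment> \<open>The continuation reads the profile only at lists starting with
        \<open>a\<close>, so the change at \<open>[]\<close> is invisible.\<close>
      moreover have "continuation [a] (s(i := (s i)([] := a))) = continuation [a] s"
        by (auto simp: continuation_def)
      ultimately show ?thesis
        by simp
    qed
    ultimately show "locally_optimal (Decision i A G) s"
      using IH by simp
  next
    assume opt: "locally_optimal (Decision i A G) s"
    then have spe: "subgame_perfect_equilibrium (G a) (continuation [a] s)" if "a \<in> A" for a
      using IH that by simp
    have "nash_equilibrium (Decision i A G) s"
      using opt by (intro nash_equilibrium_Decision s subgame_perfect_equilibrium_imp_nash spe) auto
    moreover have "nash_equilibrium (subgame (G a) h) (continuation (a # h) s)"
      if "a \<in> A" "h \<in> decision_nodes (G a) j" for a h j
      using spe[OF that(1)] that(2) by (simp add: subgame_perfect_equilibrium_def)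
    ultimately show "subgame_perfect_equilibrium (Decision i A G) s"
      using s by (auto simp: subgame_perfect_equilibrium_def)
  qed
qed

section \<open>Equilibria of the escrow contract\<close>

lemma decision_nodes_escrow:
  "decision_nodes (escrow x x' y \<gamma> lam) Seller = {[], [Send, Dispute], [NotSend, Dispute]}"
  "decision_nodes (escrow x x' y \<gamma> lam) Buyer = {[Send], [NotSend]}"
  by (auto simp: escrow_def outcome_def)

lemma profiles_escrow_iff:
  "s \<in> profiles (escrow x x' y \<gamma> lam) \<longleftrightarrow>
     s Seller [] \<in> {Send, NotSend} \<and>
     s Buyer [Send] \<in> {Accept, Dispute} \<and>
     s Buyer [NotSend] \<in> {Accept, Dispute} \<and>
     s Seller [Send, Dispute] \<in> {Forfeit, Counter} \<and>
     s Seller [NotSend, Dispute] \<in> {Forfeit, Counter} \<and>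
     s Seller \<in> extensional {[], [Send, Dispute], [NotSend, Dispute]} \<and>
     s Buyer \<in> extensional {[Send], [NotSend]}"
proof -
  have "(\<forall>i. P i) \<longleftrightarrow> P Seller \<and> P Buyer" for P
    by (metis player.exhaust)
  then show ?thesis
    by (simp add: profiles_def strategies_def decision_nodes_escrow PiE_iff)
       (auto simp: escrow_def outcome_def)
qed

lemma honest_in_profiles: "honest \<in> profiles (escrow x x' y \<gamma> lam)"
  by (auto simp: profiles_escrow_iff honest_def extensional_def)

text \<open>The two inequalities are the seller's choices after a dispute. The second implies that
  accepting is optimal after \<open>Send\<close>; the remaining two comparisons are
  \<open>- x \<le> 0\<close> and \<open>0 \<le> x - x'\<close>.\<close>

lemma honest_equilibrium_iff:
  assumes "y > x" and "x > x'" and "x' \<ge> 0" and "0 \<le> \<gamma>" and "\<gamma> < 1"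
  shows "subgame_perfect_equilibrium (escrow x x' y \<gamma> lam) honest \<longleftrightarrow>
     lam * \<gamma> \<le> x * (1 - \<gamma>) \<and> x * \<gamma> \<le> lam * (1 - \<gamma>)"
proof -
  have "y * \<gamma> - (x + lam) * (1 - \<gamma>) \<le> y - x" if "x * \<gamma> \<le> lam * (1 - \<gamma>)"
  proof -
    \<comment> \<open>Right side minus left side of the goal equals
      \<open>y * (1 - \<gamma>) + (lam * (1 - \<gamma>) - x * \<gamma>)\<close>.\<close>
    have "y * (1 - \<gamma>) > 0"
      using assms by simp
    then show ?thesis
      using that by (simp add: algebra_simps)
  qed
  then show ?thesis
    using assms unfolding subgame_perfect_equilibrium_iff_locally_optimal[OF honest_in_profiles]
    by (auto simp: escrow_def outcome_def honest_def algebra_simps)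
qed

lemma complete_contract_same_wager:
  assumes "y > x" and "x > x'" and "x' \<ge> 0" and "0 \<le> \<gamma>" and "\<gamma> < 1 / 2"
  shows "complete_contract x x' y \<gamma> x"
  unfolding complete_contract_def
proof (intro allI iffI)
  fix s
  assume spe: "subgame_perfect_equilibrium (escrow x x' y \<gamma> x) s"
  then have s: "s \<in> profiles (escrow x x' y \<gamma> x)"
    by (simp add: subgame_perfect_equilibrium_def)
  note acts = s[unfolded profiles_escrow_iff]
  have opt: "locally_optimal (escrow x x' y \<gamma> x) s"
    using spe subgame_perfect_equilibrium_iff_locally_optimal[OF s] by simp
  \<comment> \<open>With \<open>lam = x\<close>, countering instead of forfeiting changes the
    seller's payoff by \<open>x * (1 - 2 * \<gamma>)\<close> after \<open>Send\<close> and by its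
    negative after \<open>NotSend\<close>. The second fact settles the buyer's choice after
    \<open>Send\<close>.\<close>
  have pos: "x * (1 - 2 * \<gamma>) > 0" "y * \<gamma> - (x + x) * (1 - \<gamma>) < y - x"
  proof -
    show "x * (1 - 2 * \<gamma>) > 0"
      using assms by simp
    moreover have "y * (1 - \<gamma>) > 0"
      using assms by simp
    ultimately show "y * \<gamma> - (x + x) * (1 - \<gamma>) < y - x"
      by (simp add: algebra_simps)
  qed
  \<comment> \<open>Actions are determined from the last movers back to the root, since each
    comparison uses the later choices.\<close>
  have "s Seller [Send, Dispute] = Counter" "s Seller [NotSend, Dispute] = Forfeit"
    using acts opt pos by (auto simp: escrow_def outcome_def algebra_simps)
  moreover from this have "s Buyer [Send] = Accept" "s Buyer [NotSend] = Dispute"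
    using acts opt pos assms(1-3) by (auto simp: escrow_def outcome_def algebra_simps)
  moreover from calculation have "s Seller [] = Send"
    using acts opt assms by (auto simp: escrow_def outcome_def algebra_simps)
  ultimately have "s i h = honest i h" if "h \<in> decision_nodes (escrow x x' y \<gamma> x) i" for i h
    using that by (cases i) (auto simp: decision_nodes_escrow honest_def)
  then show "s = honest"
    using profiles_eqI[OF s honest_in_profiles] by blast
next
  fix s
  assume "s = honest"
  moreover have "x * \<gamma> \<le> x * (1 - \<gamma>)"
    using assms by (intro mult_left_mono) auto
  ultimately show "subgame_perfect_equilibrium (escrow x x' y \<gamma> x) s"
    using assms by (simp add: honest_equilibrium_iff)
qed

text \<open>Countering after an unsent item now gives the seller 0, as forfeiting does. It costs the
  buyer \<open>x\<close>, as accepting does, so disputing stays optimal, and sending still earns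
  \<open>x - x' > 0\<close>.\<close>

lemma not_complete_contract_half:
  assumes "y > x" and "x > x'" and "x' \<ge> 0"
  shows "\<not> complete_contract x x' y (1 / 2) x"
proof -
  define s where "s = honest(Seller := (honest Seller)([NotSend, Dispute] := Counter))"
  have s: "s \<in> profiles (escrow x x' y (1 / 2) x)"
    by (auto simp: s_def profiles_escrow_iff honest_def extensional_def)
  have "subgame_perfect_equilibrium (escrow x x' y (1 / 2) x) s"
    using assms unfolding subgame_perfect_equilibrium_iff_locally_optimal[OF s]
    by (auto simp: s_def escrow_def outcome_def honest_def field_simps)
  moreover have "s Seller [NotSend, Dispute] \<noteq> honest Seller [NotSend, Dispute]"
    by (simp add: s_def honest_def)
  ultimately show ?thesis
    unfolding complete_contract_def by metis
qed

theorem lemma2: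
  fixes x x' y \<gamma> :: real
  assumes "y > x" and "x > x'" and "x' \<ge> 0"
    and "0 \<le> \<gamma>" and "\<gamma> < 1"
  shows "(\<exists>lam>0. complete_contract x x' y \<gamma> lam) \<longleftrightarrow> biased_for_honest \<gamma>"
proof
  assume "\<exists>lam>0. complete_contract x x' y \<gamma> lam"
  then obtain lam where lam: "lam > 0" "complete_contract x x' y \<gamma> lam"
    by blast
  then have "subgame_perfect_equilibrium (escrow x x' y \<gamma> lam) honest"
    by (simp add: complete_contract_def)
  then have le: "lam * \<gamma> \<le> x * (1 - \<gamma>)" "x * \<gamma> \<le> lam * (1 - \<gamma>)"
    using assms by (auto simp: honest_equilibrium_iff)
  \<comment> \<open>Sum of the two conditions; the factor \<open>lam + x\<close> is positive and
    cancels.\<close>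
  have "(lam + x) * \<gamma> \<le> (lam + x) * (1 - \<gamma>)"
    using le by (simp add: algebra_simps)
  then have "\<gamma> \<le> 1 / 2"
    using lam assms by simp
  moreover have "\<gamma> \<noteq> 1 / 2"
  proof
    assume "\<gamma> = 1 / 2"
    \<comment> \<open>The conditions become \<open>lam \<le> x\<close> and
      \<open>x \<le> lam\<close>.\<close>
    with le have "lam = x"
      by simp
    with \<open>\<gamma> = 1 / 2\<close> lam not_complete_contract_half assms show False
      by blast
  qed
  ultimately show "biased_for_honest \<gamma>"
    by (simp add: biased_for_honest_def)
next
  assume "biased_for_honest \<gamma>"
  then have "complete_contract x x' y \<gamma> x"
    using assms by (intro complete_contract_same_wager) (auto simp: biased_for_honest_def)
  then show "\<exists>lam>0. complete_contract x x' y \<gamma> lam"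
    using assms by (intro exI[of _ x]) auto
qed

end
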